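(* Let $I\subseteq\mathbb{R}$ be an interval, let $G:I\to(0,1)$ be a continuous strictly increasing bijection, and let $X,X_1,\ldots,X_n$ ($n\ge1$) be i.i.d. with law $P$, $P(I)=1$. Let $p_G=\mathbb{E}[G(X)]$, $b_G=G^{-1}(p_G)$ and $\widehat p_G=\frac1n\sum_{i=1}^nG(X_i)$. For $\alpha\in(0,1)$ let $\varepsilon_{n,\alpha}=\sqrt{\log(2/\alpha)/(2n)}$. Then $$\mathbb{P}\left(|\widehat p_G-p_G|\le\varepsilon_{n,\alpha}\right)\ge1-\alpha,$$ and the set $$C_{b,n}(\alpha)=G^{-1}\left([\widehat p_G-\varepsilon_{n,\alpha},\ \widehat p_G+\varepsilon_{n,\alpha}]\cap[0,1]\right)$$ satisfies $\mathbb{P}(b_G\in C_{b,n}(\alpha))\ge1-\alpha$.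
   Context: The inverse is extended by the convention $G^{-1}(0)=\inf I$ and $G^{-1}(1)=\sup I$ (possibly $\mp\infty$), and $G^{-1}(A)$ denotes the image of $A\subseteq[0,1]$ under this extended inverse. *)

theory Defs
  imports "HOL-Probability.Probability"
begin

text \<open>The measurability of each \<open>Y i\<close> is part of \<^const>\<open>prob_space.indep_vars\<close>.\<close>

definition iid_with_law :: "'a measure \<Rightarrow> real measure \<Rightarrow> ('i \<Rightarrow> 'a \<Rightarrow> real) \<Rightarrow> 'i set \<Rightarrow> bool" where
  "iid_with_law M P Y J \<longleftrightarrow>
     prob_space.indep_vars M (\<lambda>_. borel) Y J \<and> (\<forall>i\<in>J. distr M borel (Y i) = P)"

text \<open>
  A map \<open>G\<close> on \<open>I\<close> is modelled by a function on all reals whose values off \<open>I\<close> are arbitrary,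
  possibly not even measurable. Observations lie in \<open>I\<close> only almost surely, so \<open>G (X \<omega>)\<close> is
  read as \<open>0\<close> on the null event that \<open>X \<omega>\<close> is outside \<open>I\<close>.
\<close>

definition on_interval :: "real set \<Rightarrow> (real \<Rightarrow> real) \<Rightarrow> real \<Rightarrow> real" where
  "on_interval I G x = (if x \<in> I then G x else 0)"

definition p_mean :: "'a measure \<Rightarrow> real set \<Rightarrow> (real \<Rightarrow> real) \<Rightarrow> ('a \<Rightarrow> real) \<Rightarrow> real" where
  "p_mean M I G X = (\<integral>\<omega>. on_interval I G (X \<omega>) \<partial>M)"

definition b_mean :: "'a measure \<Rightarrow> real set \<Rightarrow> (real \<Rightarrow> real) \<Rightarrow> ('a \<Rightarrow> real) \<Rightarrow> real" where
  "b_mean M I G X = the_inv_into I G (p_mean M I G X)"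

definition p_hat :: "real set \<Rightarrow> (real \<Rightarrow> real) \<Rightarrow> (nat \<Rightarrow> 'a \<Rightarrow> real) \<Rightarrow> nat \<Rightarrow> 'a \<Rightarrow> real" where
  "p_hat I G Xs n \<omega> = (1 / real n) * (\<Sum>i=1..n. on_interval I G (Xs i \<omega>))"

definition hoeffding_radius :: "nat \<Rightarrow> real \<Rightarrow> real" where
  "hoeffding_radius n \<alpha> = sqrt (ln (2 / \<alpha>) / (2 * real n))"

text \<open>
  The inverse of \<open>G\<close> extended to \<open>[0,1]\<close>; its values at \<open>0\<close> and \<open>1\<close> may be infinite.
  It is only meaningful for arguments in \<open>[0,1]\<close>.
\<close>

definition ext_inverse :: "real set \<Rightarrow> (real \<Rightarrow> real) \<Rightarrow> real \<Rightarrow> ereal" where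
  "ext_inverse I G p =
     (if p = 0 then (INF x\<in>I. ereal x)
      else if p = 1 then (SUP x\<in>I. ereal x)
      else ereal (the_inv_into I G p))"

definition conf_set ::
  "real set \<Rightarrow> (real \<Rightarrow> real) \<Rightarrow> (nat \<Rightarrow> 'a \<Rightarrow> real) \<Rightarrow> nat \<Rightarrow> real \<Rightarrow> 'a \<Rightarrow> ereal set" where
  "conf_set I G Xs n \<alpha> \<omega> =
     ext_inverse I G ` ({p_hat I G Xs n \<omega> - hoeffding_radius n \<alpha> ..
                         p_hat I G Xs n \<omega> + hoeffding_radius n \<alpha>} \<inter> {0..1})"

end

theory Submission
  imports Defs
begin

text \<open>
  The variables \<open>G (Xs i)\<close> are i.i.d. with values in \<open>[0,1]\<close> and mean \<open>p\<^sub>G\<close>, so the first bound is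
  Hoeffding's inequality with a radius at which its right-hand side is exactly \<open>\<alpha>\<close>. As \<open>G (X)\<close> lies
  strictly between 0 and 1 almost surely, so does \<open>p\<^sub>G\<close>. An interval with a strictly monotone
  bijection onto \<open>(0,1)\<close> contains neither of its endpoints, hence the extended inverse takes the
  value \<open>b\<^sub>G\<close> only at \<open>p\<^sub>G\<close>, and the two events of the theorem coincide.
\<close>

text \<open>\<open>G\<close> may be wild off \<open>I\<close>, but \<open>on_interval\<close> puts a
  constant there and \<open>I\<close> is Borel, so continuity on \<open>I\<close> suffices.\<close>

lemma borel_measurable_on_interval:
  assumes "is_interval I" and "continuous_on I G"
  shows "on_interval I G \<in> borel_measurable borel"
proof -
  have "I \<in> sets borel"
    using assms(1) by (rule real_interval_borel_measurable)
  then show ?thesis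
    unfolding on_interval_def[abs_def]
    using assms(2) by (intro borel_measurable_continuous_on_if) auto
qed

lemma ext_inverse_eq_iff:
  assumes mono: "strict_mono_on I G" and bij: "bij_betw G I {0<..<1}"
    and p: "p \<in> {0<..<1}" and q: "q \<in> {0..1}"
  shows "ext_inverse I G q = ereal (the_inv_into I G p) \<longleftrightarrow> q = p"
proof -
  let ?b = "the_inv_into I G"
  have inv_bij: "bij_betw ?b {0<..<1} I"
    using bij by (rule bij_betw_the_inv_into)
  have Gb: "G (?b r) = r" if "r \<in> {0<..<1}" for r
    using bij that by (simp add: f_the_inv_into_f_bij_betw)
  have bI: "?b r \<in> I" if "r \<in> {0<..<1}" for r
    using inv_bij that by (rule bij_betw_apply)
  have b_less: "?b r < ?b s" if "r \<in> {0<..<1}" "s \<in> {0<..<1}" "r < s" for r s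
    using strict_mono_on_less[OF mono bI[OF that(1)] bI[OF that(2)]] Gb that by simp
  \<comment> \<open>\<open>p / 2\<close> again lies in \<open>{0<..<1}\<close>, so its preimage is a
    point of \<open>I\<close> strictly left of \<open>?b p\<close>. This separates
    \<open>?b p\<close> from the infimum, finite or not; the midpoint of \<open>p\<close> and 1 does
    the same for the supremum.\<close>
  have "(INF x\<in>I. ereal x) \<le> ereal (?b (p / 2))"
    using bI[of "p / 2"] p by (intro INF_lower) auto
  also have "\<dots> < ereal (?b p)"
    using b_less[of "p / 2" p] p by auto
  finally have lower: "(INF x\<in>I. ereal x) < ereal (?b p)" .
  have "ereal (?b p) < ereal (?b ((p + 1) / 2))"
    using b_less[of p "(p + 1) / 2"] p by auto
  also have "\<dots> \<le> (SUP x\<in>I. ereal x)"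
    using bI[of "(p + 1) / 2"] p by (intro SUP_upper) auto
  finally have upper: "ereal (?b p) < (SUP x\<in>I. ereal x)" .
  have "?b q = ?b p \<longleftrightarrow> q = p" if "q \<in> {0<..<1}"
    using Gb p that by metis
  then show ?thesis
    using lower upper p q by (auto simp: ext_inverse_def)
qed

text \<open>The equivalence is pointwise in \<open>\<omega>\<close>, so the event about
  \<open>conf_set\<close> is the same set as the event about \<open>p_hat\<close> and inherits its
  probability bound.\<close>

lemma b_mean_in_conf_set_iff:
  assumes "strict_mono_on I G" and "bij_betw G I {0<..<1}"
    and p: "p_mean M I G X \<in> {0<..<1}"
  shows "ereal (b_mean M I G X) \<in> conf_set I G Xs n \<alpha> \<omega> \<longleftrightarrow>
         \<bar>p_hat I G Xs n \<omega> - p_mean M I G X\<bar> \<le> hoeffding_radius n \<alpha>"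
proof -
  let ?J = "{p_hat I G Xs n \<omega> - hoeffding_radius n \<alpha>..p_hat I G Xs n \<omega> + hoeffding_radius n \<alpha>}"
  have "ereal (b_mean M I G X) \<in> conf_set I G Xs n \<alpha> \<omega> \<longleftrightarrow>
        (\<exists>q\<in>?J \<inter> {0..1}. ereal (the_inv_into I G (p_mean M I G X)) = ext_inverse I G q)"
    by (simp only: conf_set_def b_mean_def image_iff)
  also have "\<dots> \<longleftrightarrow> (\<exists>q\<in>?J \<inter> {0..1}. q = p_mean M I G X)"
    using ext_inverse_eq_iff[OF assms] by (metis IntD2)
  also have "\<dots> \<longleftrightarrow> p_mean M I G X \<in> ?J"
    using p by auto
  finally show ?thesis
    by (auto simp: abs_le_iff)
qed

lemma hoeffding_radius_pos:
  assumes "n \<ge> 1" and "0 < \<alpha>" and "\<alpha> < 1"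
  shows "hoeffding_radius n \<alpha> > 0"
  using assms by (simp add: hoeffding_radius_def)

lemma exp_hoeffding_radius:
  assumes "n \<ge> 1" and "0 < \<alpha>" and "\<alpha> < 1"
  shows "2 * exp (- 2 * real n * (hoeffding_radius n \<alpha>)\<^sup>2) = \<alpha>"
proof -
  \<comment> \<open>The sign lets the square cancel the square root in the radius.\<close>
  have "ln (2 / \<alpha>) > 0"
    using assms by simp
  then have "- 2 * real n * (hoeffding_radius n \<alpha>)\<^sup>2 = - ln (2 / \<alpha>)"
    using assms by (simp add: hoeffding_radius_def)
  then show ?thesis
    using assms by (simp only: exp_minus) simp
qed

context prob_space
begin

text \<open>The hypothesis on the law of \<open>X\<close> says that \<open>X\<close> lies in
  \<open>I\<close> almost surely; there \<open>on_interval\<close> agrees with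
  \<open>G\<close>.\<close>

lemma AE_on_interval_in_unit:
  assumes "is_interval I" and "G ` I \<subseteq> {0<..<1}"
    and X: "random_variable borel X" and "measure (distr M borel X) I = 1"
  shows "AE \<omega> in M. on_interval I G (X \<omega>) \<in> {0<..<1}"
proof -
  have I: "I \<in> sets borel"
    using assms(1) by (rule real_interval_borel_measurable)
  interpret D: prob_space "distr M borel X"
    using X by (rule prob_space_distr)
  have "AE x in distr M borel X. x \<in> I"
    using assms(4) I by (subst D.prob_eq_1[symmetric]) auto
  then have "AE \<omega> in M. X \<omega> \<in> I"
    using X I by (simp add: AE_distr_iff)
  then show ?thesis
    by eventually_elim (use assms(2) in \<open>auto simp: on_interval_def\<close>)
qed

text \<open>Strict bounds survive integration because the total mass is 1. Applied to
  \<open>G\<close> at \<open>X\<close>, this keeps the mean off 0 and 1, where \<open>G\<close> has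
  no preimage.\<close>

lemma expectation_in_open_interval:
  fixes f :: "'a \<Rightarrow> real"
  assumes f: "f \<in> borel_measurable M" and bounds: "AE \<omega> in M. f \<omega> \<in> {a<..<b}"
  shows "expectation f \<in> {a<..<b}"
proof -
  have "integrable M f"
    by (intro integrable_const_bound[where B = "max \<bar>a\<bar> \<bar>b\<bar>"] f eventually_mono[OF bounds]) auto
  moreover have "AE \<omega> in M. a < f \<omega>" "AE \<omega> in M. f \<omega> < b"
    using bounds by auto
  ultimately show ?thesis
    using expectation_greater expectation_less by auto
qed

lemma prob_p_hat_close_ge:
  assumes "is_interval I" and "continuous_on I G" and "G ` I \<subseteq> {0<..<1}" and n: "n \<ge> 1"
    and iid: "iid_with_law M P (Xs(0 := X)) {0..n}" and "measure P I = 1"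
    and \<alpha>: "0 < \<alpha>" "\<alpha> < 1"
  shows "prob {\<omega> \<in> space M. \<bar>p_hat I G Xs n \<omega> - p_mean M I G X\<bar> \<le> hoeffding_radius n \<alpha>}
         \<ge> 1 - \<alpha>"
proof -
  let ?g = "on_interval I G"
  let ?\<epsilon> = "hoeffding_radius n \<alpha>"
  have g: "?g \<in> borel_measurable borel"
    using assms(1,2) by (rule borel_measurable_on_interval)
  have indep: "indep_vars (\<lambda>_. borel) (Xs(0 := X)) {0..n}"
    and law: "\<And>i. i \<in> {0..n} \<Longrightarrow> distr M borel ((Xs(0 := X)) i) = P"
    using iid by (auto simp: iid_with_law_def)
  have X: "random_variable borel X"
    using indep by (auto simp: indep_vars_def dest: bspec[of _ _ 0])
  have Xs: "random_variable borel (Xs i)" if "i \<in> {1..n}" for i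
    using indep that by (auto simp: indep_vars_def dest!: bspec[of _ _ i])
  have law_X: "distr M borel X = P"
    using law[of 0] by simp
  have law_Xs: "distr M borel (Xs i) = P" if "i \<in> {1..n}" for i
    using law[of i] that by simp
  \<comment> \<open>Index 0 holds \<open>X\<close> itself; dropping it leaves the actual
    sample.\<close>
  have "indep_vars (\<lambda>_. borel) (Xs(0 := X)) {1..n}"
    using indep by (rule indep_vars_subset) auto
  then have indep_Xs: "indep_vars (\<lambda>_. borel) Xs {1..n}"
    by (subst indep_vars_cong[where Y = "Xs(0 := X)"]) auto
  \<comment> \<open>The transformed \<open>X\<close> represents the common law. The range has width
    1, which gives the exponent \<open>- 2 * real n * ?\<epsilon>\<^sup>2\<close>.\<close>
  interpret H: Hoeffding_ineq_iid M "{1..n}" "\<lambda>i \<omega>. ?g (Xs i \<omega>)" "\<lambda>\<omega>. ?g (X \<omega>)" 0 1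
    "p_mean M I G X"
  proof unfold_locales
    show "indep_vars (\<lambda>_. borel) (\<lambda>i \<omega>. ?g (Xs i \<omega>)) {1..n}"
      using indep_Xs g by (rule indep_vars_compose2)
    show "distr M borel (\<lambda>\<omega>. ?g (Xs i \<omega>)) = distr M borel (\<lambda>\<omega>. ?g (X \<omega>))"
      if "i \<in> {1..n}" for i
      using distr_distr[OF g Xs[OF that]] distr_distr[OF g X] law_X law_Xs[OF that]
      by (simp add: comp_def)
    show "random_variable borel (\<lambda>\<omega>. ?g (X \<omega>))"
      using X g by (rule measurable_compose)
    have "AE \<omega> in M. ?g (X \<omega>) \<in> {0<..<1}"
      using assms(1,3,6) X law_X by (intro AE_on_interval_in_unit) auto
    then show "AE \<omega> in M. ?g (X \<omega>) \<in> {0..1}"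
      by eventually_elim auto
  qed (auto simp: p_mean_def)
  have p_hat: "p_hat I G Xs n \<omega> = (\<Sum>i=1..n. ?g (Xs i \<omega>)) / real (card {1..n})" for \<omega>
    by (simp add: p_hat_def)
  have [measurable]: "p_hat I G Xs n \<in> borel_measurable M"
    unfolding p_hat_def[abs_def]
    by (intro borel_measurable_times borel_measurable_sum borel_measurable_const
        measurable_compose[OF Xs g])
  \<comment> \<open>The complement is a strict deviation, contained in the non-strict one that
    Hoeffding's inequality bounds.\<close>
  have "prob {\<omega> \<in> space M. \<not> \<bar>p_hat I G Xs n \<omega> - p_mean M I G X\<bar> \<le> ?\<epsilon>}
      \<le> prob {\<omega> \<in> space M. \<bar>p_hat I G Xs n \<omega> - p_mean M I G X\<bar> \<ge> ?\<epsilon>}"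
    by (intro finite_measure_mono) auto
  also have "\<dots> \<le> 2 * exp (- 2 * real n * ?\<epsilon>\<^sup>2)"
    using H.Hoeffding_ineq_abs_ge'[of ?\<epsilon>] hoeffding_radius_pos[OF n \<alpha>] n
    by (simp add: p_hat)
  also have "\<dots> = \<alpha>"
    using n \<alpha> by (rule exp_hoeffding_radius)
  finally show ?thesis
    by (subst (asm) prob_neg) auto
qed

end

theorem corollary3p4:
  fixes I :: "real set" and G :: "real \<Rightarrow> real"
    and M :: "'a measure" and P :: "real measure"
    and X :: "'a \<Rightarrow> real" and Xs :: "nat \<Rightarrow> 'a \<Rightarrow> real"
    and n :: nat and \<alpha> :: real
  assumes "is_interval I"
    and "continuous_on I G" and "strict_mono_on I G" and "bij_betw G I {0<..<1}"
    and "prob_space M" and "n \<ge> 1"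
    and "iid_with_law M P (Xs(0 := X)) {0..n}"
    and "measure P I = 1"
    and "0 < \<alpha>" and "\<alpha> < 1"
  shows "measure M {\<omega> \<in> space M.
           \<bar>p_hat I G Xs n \<omega> - p_mean M I G X\<bar> \<le> hoeffding_radius n \<alpha>} \<ge> 1 - \<alpha>
       \<and> measure M {\<omega> \<in> space M. ereal (b_mean M I G X) \<in> conf_set I G Xs n \<alpha> \<omega>} \<ge> 1 - \<alpha>"
proof -
  interpret prob_space M
    by (rule assms(5))
  have img: "G ` I \<subseteq> {0<..<1}"
    using assms(4) by (simp add: bij_betw_def)
  have X: "random_variable borel X" and law_X: "distr M borel X = P"
    using assms(7) by (auto simp: iid_with_law_def indep_vars_def dest: bspec[of _ _ 0])
  have "p_mean M I G X \<in> {0<..<1}"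
    unfolding p_mean_def
    using assms(1,8) img X law_X
    by (intro expectation_in_open_interval AE_on_interval_in_unit
        measurable_compose[OF X borel_measurable_on_interval[OF assms(1,2)]]) auto
  then show ?thesis
    using prob_p_hat_close_ge[OF assms(1,2) img assms(6,7,8,9,10)]
    by (simp only: b_mean_in_conf_set_iff[OF assms(3,4)])
qed

end
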